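(* Assume $MA_{\omega_1}$. Let $K\subseteq[0,\infty)$ be countable, let $(X,d)$ be a rectangular, hereditarily separably saturated metric space of cardinality $\omega_1$ with distances in $K$, and let $Y\subseteq X$ be an uncountable subspace which is hereditarily separably saturated. Then $X$ and $Y$ are isometric.
   Context: Tuples $(x_1,\dots,x_n),(y_1,\dots,y_n)\in X^n$ are alike if $d(x_i,y_i)=d(x_j,y_j)$ and $d(x_i,x_j)=d(y_i,y_j)$ for all $i,j$, and $d(x_i,x_j)=d(x_i,y_j)$ whenever $x_i\neq x_j$. $(X,d)$ is rectangular if it is uncountable and for every $n$ and every family of $\omega_1$ many tuples in $X^n$ with pairwise disjoint entry sets, two distinct members are alike. For a metric space $Z$ with distances in $K$, $D\subseteq Z$ is saturating if for every finite $E\subseteq Z$ and every metric space $E\cup\{f\}$ ($f\notin E$) with distances in $K$ extending the metric of $E$, there is $\delta\in D$ with the map fixing $E$ and sending $f\mapsto\delta$ an isometry onto $E\cup\{\delta\}$. $Z$ is separably saturated if it has a countable saturating subset, and hereditarily separably saturated if $Z\setminus A$ is separably saturated for every countable $A\subseteq Z$. *)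

theory Defs
  imports "HOL-Analysis.Analysis"
begin

unbundle cardinal_syntax

definition omega1 :: "nat set rel" where
  "omega1 = cardSuc natLeq"

section \<open>Martin's Axiom\<close>

text \<open>A pair \<open>(p, q) \<in> r\<close> means \<open>p \<le> q\<close>, i.e. \<open>p\<close> is the stronger condition.\<close>

definition compatible_in :: "'p set \<Rightarrow> 'p rel \<Rightarrow> 'p \<Rightarrow> 'p \<Rightarrow> bool" where
  "compatible_in P r p q \<longleftrightarrow> (\<exists>s\<in>P. (s, p) \<in> r \<and> (s, q) \<in> r)"

definition ccc :: "'p set \<Rightarrow> 'p rel \<Rightarrow> bool" where
  "ccc P r \<longleftrightarrow>
     (\<forall>A\<subseteq>P. pairwise (\<lambda>p q. \<not> compatible_in P r p q) A \<longrightarrow> countable A)"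

definition dense_in_poset :: "'p set \<Rightarrow> 'p rel \<Rightarrow> 'p set \<Rightarrow> bool" where
  "dense_in_poset P r D \<longleftrightarrow> D \<subseteq> P \<and> (\<forall>p\<in>P. \<exists>q\<in>D. (q, p) \<in> r)"

definition filter_in_poset :: "'p set \<Rightarrow> 'p rel \<Rightarrow> 'p set \<Rightarrow> bool" where
  "filter_in_poset P r G \<longleftrightarrow>
     G \<subseteq> P \<and> G \<noteq> {} \<and>
     (\<forall>p\<in>G. \<forall>q\<in>P. (p, q) \<in> r \<longrightarrow> q \<in> G) \<and>
     (\<forall>p\<in>G. \<forall>q\<in>G. \<exists>s\<in>G. (s, p) \<in> r \<and> (s, q) \<in> r)"

text \<open>
  HOL cannot quantify over all types inside a formula, so Martin's Axiom for \<open>\<omega>\<^sub>1\<close> many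
  dense sets is stated for all posets whose underlying set is a subset of a given type \<open>'p\<close>.
  Every poset of cardinality at most that of \<open>'p\<close> has a copy there. The axiom for all posets
  is equivalent to the axiom for posets of cardinality at most \<open>\<omega>\<^sub>1\<close> (pass to a suborder of
  size \<open>\<omega>\<^sub>1\<close>), so for any uncountable \<open>'p\<close> this is equivalent to the full axiom; for countable
  \<open>'p\<close> it only concerns countable posets and is strictly weaker.
\<close>

definition MA_omega1 :: "'p itself \<Rightarrow> bool" where
  "MA_omega1 TYPE('p) \<longleftrightarrow>
     (\<forall>(P :: 'p set) r. P \<noteq> {} \<and> partial_order_on P r \<and> ccc P r \<longrightarrow>
        (\<forall>\<D>. |\<D>| \<le>o omega1 \<and> (\<forall>D\<in>\<D>. dense_in_poset P r D) \<longrightarrow>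
           (\<exists>G. filter_in_poset P r G \<and> (\<forall>D\<in>\<D>. G \<inter> D \<noteq> {}))))"

section \<open>Metric spaces\<close>

definition distances_in :: "real set \<Rightarrow> 'a set \<Rightarrow> ('a \<Rightarrow> 'a \<Rightarrow> real) \<Rightarrow> bool" where
  "distances_in K X d \<longleftrightarrow> (\<forall>x\<in>X. \<forall>y\<in>X. d x y \<in> K)"

definition isometry_onto ::
  "'a set \<Rightarrow> ('a \<Rightarrow> 'a \<Rightarrow> real) \<Rightarrow> 'b set \<Rightarrow> ('b \<Rightarrow> 'b \<Rightarrow> real) \<Rightarrow> ('a \<Rightarrow> 'b) \<Rightarrow> bool" where
  "isometry_onto X d Y e g \<longleftrightarrow>
     bij_betw g X Y \<and> (\<forall>x\<in>X. \<forall>y\<in>X. e (g x) (g y) = d x y)"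

definition isometric ::
  "'a set \<Rightarrow> ('a \<Rightarrow> 'a \<Rightarrow> real) \<Rightarrow> 'b set \<Rightarrow> ('b \<Rightarrow> 'b \<Rightarrow> real) \<Rightarrow> bool" where
  "isometric X d Y e \<longleftrightarrow> (\<exists>g. isometry_onto X d Y e g)"

text \<open>Tuples are lists; \<open>alike\<close> is only used for lists of the same length.\<close>

definition alike :: "('a \<Rightarrow> 'a \<Rightarrow> real) \<Rightarrow> 'a list \<Rightarrow> 'a list \<Rightarrow> bool" where
  "alike d xs ys \<longleftrightarrow>
     (\<forall>i<length xs. \<forall>j<length xs.
        d (xs ! i) (ys ! i) = d (xs ! j) (ys ! j) \<and>
        d (xs ! i) (xs ! j) = d (ys ! i) (ys ! j) \<and>
        (xs ! i \<noteq> xs ! j \<longrightarrow> d (xs ! i) (xs ! j) = d (xs ! i) (ys ! j)))"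

definition rectangular :: "'a set \<Rightarrow> ('a \<Rightarrow> 'a \<Rightarrow> real) \<Rightarrow> bool" where
  "rectangular X d \<longleftrightarrow>
     uncountable X \<and>
     (\<forall>n F. F \<subseteq> {xs. length xs = n \<and> set xs \<subseteq> X} \<and> |F| =o omega1 \<and>
            disjoint_family_on set F \<longrightarrow>
        (\<exists>xs\<in>F. \<exists>ys\<in>F. xs \<noteq> ys \<and> alike d xs ys))"

text \<open>
  The new point \<open>f\<close> is taken from the ambient type and may or may not lie in \<open>Z\<close>; it serves
  only as a name. As long as the ambient type is infinite, every one-point extension of a
  finite \<open>E\<close> has an isometric copy over \<open>E\<close> of this form.
\<close>

definition saturating ::
  "real set \<Rightarrow> 'a set \<Rightarrow> ('a \<Rightarrow> 'a \<Rightarrow> real) \<Rightarrow> 'a set \<Rightarrow> bool" where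
  "saturating K Z d D \<longleftrightarrow>
     D \<subseteq> Z \<and>
     (\<forall>E f d'. finite E \<and> E \<subseteq> Z \<and> f \<notin> E \<and>
               Metric_space (insert f E) d' \<and> distances_in K (insert f E) d' \<and>
               (\<forall>x\<in>E. \<forall>y\<in>E. d' x y = d x y) \<longrightarrow>
        (\<exists>\<delta>\<in>D. isometry_onto (insert f E) d' (insert \<delta> E) d (id(f := \<delta>))))"

definition separably_saturated ::
  "real set \<Rightarrow> 'a set \<Rightarrow> ('a \<Rightarrow> 'a \<Rightarrow> real) \<Rightarrow> bool" where
  "separably_saturated K Z d \<longleftrightarrow> (\<exists>D. countable D \<and> saturating K Z d D)"

definition hereditarily_separably_saturated ::
  "real set \<Rightarrow> 'a set \<Rightarrow> ('a \<Rightarrow> 'a \<Rightarrow> real) \<Rightarrow> bool" where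
  "hereditarily_separably_saturated K Z d \<longleftrightarrow>
     (\<forall>A\<subseteq>Z. countable A \<longrightarrow> separably_saturated K (Z - A) d)"

end

theory Submission
  imports Defs "HOL-Library.Countable_Set_Type"
begin

text \<open>Split \<open>X\<close> into countable levels such that each level saturates \<open>X\<close> and its trace on \<open>Y\<close>
  saturates \<open>Y\<close>, and force with the finite level-preserving partial isometries from \<open>X\<close> to \<open>Y\<close>.
  Saturation makes it dense to have a given point in the domain or in the range. For the
  countable chain condition, a \<open>\<Delta>\<close>-system argument on the levels met by the conditions leaves
  uncountably many conditions that share the same restriction to the root, because only
  countably many finite maps live on finitely many countable levels. List the remainder of each
  as \<open>(a\<^sub>1, \<dots>, a\<^sub>n, b\<^sub>1, \<dots>, b\<^sub>n)\<close> with \<open>a\<^sub>i \<mapsto> b\<^sub>i\<close>; alikeness of two such tuples is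
  what is needed for the union of the two conditions to be an isometry.\<close>

section \<open>Uncountable families of sets\<close>

text \<open>Since \<open>omega1\<close> is the cardinal successor of \<open>natLeq\<close>, a
  cardinal lies strictly above \<open>natLeq\<close> exactly when it is at least
  \<open>omega1\<close>.\<close>

lemma uncountable_ordLeq_omega1: "uncountable A \<longleftrightarrow> omega1 \<le>o |A|"
proof -
  have "uncountable A \<longleftrightarrow> natLeq <o |A|"
    using countable_card_le_natLeq natLeq_Card_order
    by (metis card_of_Well_order natLeq_Well_order not_ordLess_iff_ordLeq)
  then show ?thesis
    unfolding omega1_def
    using cardSuc_ordLess_ordLeq[OF natLeq_Card_order card_of_Card_order[of A]] by simp
qed

lemma uncountable_omega1: "|A| =o omega1 \<Longrightarrow> uncountable A"
  unfolding uncountable_ordLeq_omega1 by (simp add: ordIso_iff_ordLeq)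

lemma Card_order_omega1: "Card_order omega1"
  unfolding omega1_def by (rule cardSuc_Card_order[OF natLeq_Card_order])

lemma obtain_subset_omega1:
  assumes "uncountable A"
  obtains B where "B \<subseteq> A" "|B| =o omega1"
proof -
  have "|Field omega1| \<le>o |A|"
    using assms uncountable_ordLeq_omega1 card_of_Field_ordIso[OF Card_order_omega1]
      ordIso_ordLeq_trans by blast
  then obtain g where g: "inj_on g (Field omega1)" "g ` Field omega1 \<subseteq> A"
    by (metis card_of_ordLeq)
  have "|g ` Field omega1| =o omega1"
    using g(1) card_of_Field_ordIso[OF Card_order_omega1]
    by (meson bij_betw_imageI card_of_ordIsoI ordIso_symmetric ordIso_transitive)
  then show thesis using that g(2) by blast
qed

text \<open>A set of size \<open>Suc n\<close> arises by inserting a point of \<open>A\<close> into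
  a set of size \<open>n\<close>, so by induction there are at most |A| many sets of each finite
  size. The union over all sizes adds only a countable factor.\<close>

lemma card_of_Fpow_ordLeq_infinite:
  assumes "infinite A"
  shows "|Fpow A| \<le>o |A|"
proof -
  let ?F = "\<lambda>n. {p. p \<subseteq> A \<and> finite p \<and> card p = n}"
  have "|?F n| \<le>o |A|" for n
  proof (induction n)
    case 0
    have "?F 0 = {{}}" by auto
    moreover have "A \<noteq> {}" using assms by auto
    ultimately show ?case by (metis card_of_singl_ordLeq)
  next
    case (Suc n)
    have "?F (Suc n) \<subseteq> (\<lambda>(x, q). insert x q) ` (A \<times> ?F n)"
    proof
      fix p assume p: "p \<in> ?F (Suc n)"
      then obtain x q where "p = insert x q" "x \<notin> q" "card q = n" by (auto simp: card_Suc_eq)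
      with p show "p \<in> (\<lambda>(x, q). insert x q) ` (A \<times> ?F n)"
        by (intro image_eqI[of _ _ "(x, q)"]) auto
    qed
    then have "|?F (Suc n)| \<le>o |A \<times> ?F n|"
      by (rule ordLeq_transitive[OF card_of_mono1 card_of_image])
    moreover have "|A \<times> ?F n| \<le>o |A|"
      by (rule card_of_Sigma_ordLeq_infinite[OF assms ordLeq_reflexive[OF card_of_Well_order]])
        (use Suc in blast)
    ultimately show ?case by (rule ordLeq_transitive)
  qed
  moreover have "|UNIV :: nat set| \<le>o |A|" using assms infinite_iff_card_of_nat by blast
  ultimately have "|\<Union>n\<in>UNIV. ?F n| \<le>o |A|"
    using card_of_UNION_ordLeq_infinite[OF assms, of "UNIV :: nat set" ?F] by simp
  moreover have "Fpow A = (\<Union>n\<in>UNIV. ?F n)" unfolding Fpow_def by auto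
  ultimately show ?thesis by (simp only:)
qed

section \<open>Pigeonhole, disjoint subfamilies and Delta-systems\<close>

lemma uncountable_constant_fibre:
  assumes "uncountable A" "countable (g ` A)"
  obtains c where "uncountable {a \<in> A. g a = c}"
proof -
  have "A = (\<Union>c\<in>g ` A. {a \<in> A. g a = c})" by auto
  then show thesis
    using assms that by (metis (no_types, lifting) countable_UN)
qed

text \<open>Zorn's lemma gives a maximal disjoint subfamily \<open>M\<close>. Were \<open>M\<close>
  countable, its union would be countable, and \<open>ex\<close> would supply a further member
  disjoint from that union. This serves both the Delta-system lemma and the construction of the
  levels.\<close>

lemma uncountable_disjoint_subfamily:
  fixes f :: "'a \<Rightarrow> 'b set"
  assumes countable_f: "\<And>p. p \<in> A \<Longrightarrow> countable (f p)"
    and ex: "\<And>C. countable C \<Longrightarrow> \<exists>p\<in>A. f p \<noteq> {} \<and> f p \<inter> C = {}"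
  obtains B where "B \<subseteq> A" "uncountable B" "disjoint_family_on f B"
proof -
  let ?\<A> = "{B. B \<subseteq> A \<and> disjoint_family_on f B}"
  have "\<exists>M\<in>?\<A>. \<forall>B\<in>?\<A>. M \<subseteq> B \<longrightarrow> B = M"
  proof (rule subset_Zorn_nonempty)
    show "?\<A> \<noteq> {}" by (auto simp: disjoint_family_on_def)
  next
    fix \<C> assume ch: "subset.chain ?\<A> \<C>"
    have "f m \<inter> f n = {}" if "m \<in> \<Union>\<C>" "n \<in> \<Union>\<C>" "m \<noteq> n" for m n
    proof -
      from that obtain B where "B \<in> \<C>" "m \<in> B" "n \<in> B"
        using ch unfolding subset_chain_def by (meson UnionE subsetD)
      then show ?thesis
        using ch that(3) unfolding subset_chain_def disjoint_family_on_def by blast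
    qed
    then show "\<Union>\<C> \<in> ?\<A>"
      using ch unfolding subset_chain_def disjoint_family_on_def by blast
  qed
  then obtain M where "M \<in> ?\<A>" and max: "\<forall>B\<in>?\<A>. M \<subseteq> B \<longrightarrow> B = M" ..
  then have M: "M \<subseteq> A" "disjoint_family_on f M" by simp_all
  have "uncountable M"
  proof
    assume "countable M"
    then have "countable (\<Union>p\<in>M. f p)" using M(1) countable_f by blast
    then obtain p where p: "p \<in> A" "f p \<noteq> {}" "f p \<inter> (\<Union>p\<in>M. f p) = {}"
      using ex[of "\<Union>p\<in>M. f p"] by blast
    have "disjoint_family_on f (insert p M)"
      using M(2) p(3) unfolding disjoint_family_on_def by blast
    then have "insert p M \<in> ?\<A>" using p(1) M(1) by simp
    then have "insert p M = M" using max subset_insertI by metis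
    \<comment> \<open>If \<open>p\<close> were already in \<open>M\<close>, then \<open>f p\<close>
      would be part of the union that it avoids, hence empty.\<close>
    then show False using p(2,3) by blast
  qed
  with that M show thesis by blast
qed

text \<open>Induction on the common size. If some point lies in uncountably many sets, it is removed
  from them and later added to the root. Otherwise a countable set meets only countably many
  members, so an uncountable disjoint subfamily exists and the root is empty. The family is indexed:
  distinct indices may carry equal sets.\<close>

lemma delta_system_card:
  fixes f :: "'a \<Rightarrow> 'b set"
  assumes "uncountable A" "\<And>p. p \<in> A \<Longrightarrow> finite (f p) \<and> card (f p) = n"
  shows "\<exists>B R. B \<subseteq> A \<and> uncountable B \<and> finite R \<and> (\<forall>p\<in>B. \<forall>q\<in>B. p \<noteq> q \<longrightarrow> f p \<inter> f q = R)"
  using assms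
proof (induction n arbitrary: A f)
  case 0
  then have "f p = {}" if "p \<in> A" for p using that by (metis card_0_eq)
  then show ?case using 0(1) by (intro exI[of _ A] exI[of _ "{}"]) auto
next
  case (Suc n)
  show ?case
  proof (cases "\<exists>x. uncountable {p \<in> A. x \<in> f p}")
    case True
    then obtain x where x: "uncountable {p \<in> A. x \<in> f p}" by blast
    have "\<exists>B R. B \<subseteq> {p \<in> A. x \<in> f p} \<and> uncountable B \<and> finite R \<and>
        (\<forall>p\<in>B. \<forall>q\<in>B. p \<noteq> q \<longrightarrow> (f p - {x}) \<inter> (f q - {x}) = R)"
      using Suc.prems(2) by (intro Suc.IH[OF x]) auto
    then obtain B R where B: "B \<subseteq> {p \<in> A. x \<in> f p}" "uncountable B" "finite R"
      and R: "\<forall>p\<in>B. \<forall>q\<in>B. p \<noteq> q \<longrightarrow> (f p - {x}) \<inter> (f q - {x}) = R" by (elim exE conjE)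
    have "f p \<inter> f q = insert x R" if "p \<in> B" "q \<in> B" "p \<noteq> q" for p q
    proof -
      have "(f p - {x}) \<inter> (f q - {x}) = R" "x \<in> f p" "x \<in> f q" using R that B(1) by auto
      then show ?thesis by auto
    qed
    with B show ?thesis by (intro exI[of _ B] exI[of _ "insert x R"]) auto
  next
    case False
    obtain B where "B \<subseteq> A" "uncountable B" "disjoint_family_on f B"
    proof (rule uncountable_disjoint_subfamily)
      show "countable (f p)" if "p \<in> A" for p using Suc.prems(2)[OF that] by (simp add: countable_finite)
      fix C :: "'b set" assume "countable C"
      then have "countable (\<Union>x\<in>C. {p \<in> A. x \<in> f p})" using False by auto
      then have "\<not> A \<subseteq> (\<Union>x\<in>C. {p \<in> A. x \<in> f p})"
        using Suc.prems(1) countable_subset by blast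
      then obtain p where "p \<in> A" "f p \<inter> C = {}" by blast
      moreover have "f p \<noteq> {}" using Suc.prems(2)[OF \<open>p \<in> A\<close>] by auto
      ultimately show "\<exists>p\<in>A. f p \<noteq> {} \<and> f p \<inter> C = {}" by blast
    qed
    then show ?thesis
      by (intro exI[of _ B] exI[of _ "{}"]) (auto simp: disjoint_family_on_def)
  qed
qed

lemma delta_system:
  fixes f :: "'a \<Rightarrow> 'b set"
  assumes "uncountable A" "\<And>p. p \<in> A \<Longrightarrow> finite (f p)"
  obtains B R where "B \<subseteq> A" "uncountable B" "finite R"
    "\<And>p q. p \<in> B \<Longrightarrow> q \<in> B \<Longrightarrow> p \<noteq> q \<Longrightarrow> f p \<inter> f q = R"
proof -
  obtain n where n: "uncountable {p \<in> A. card (f p) = n}"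
    using uncountable_constant_fibre[OF assms(1), of "\<lambda>p. card (f p)"] by auto
  have "\<exists>B R. B \<subseteq> {p \<in> A. card (f p) = n} \<and> uncountable B \<and> finite R \<and>
      (\<forall>p\<in>B. \<forall>q\<in>B. p \<noteq> q \<longrightarrow> f p \<inter> f q = R)"
    using assms(2) by (intro delta_system_card[OF n]) auto
  then obtain B R where "B \<subseteq> {p \<in> A. card (f p) = n}" "uncountable B" "finite R"
    and R: "\<forall>p\<in>B. \<forall>q\<in>B. p \<noteq> q \<longrightarrow> f p \<inter> f q = R" by (elim exE conjE)
  moreover from this(1) have "B \<subseteq> A" by auto
  ultimately show thesis using that[of B R] by simp
qed

section \<open>Martin's Axiom for posets on arbitrary types\<close>

text \<open>The axiom is assumed only for posets inside \<open>'p\<close>. An uncountable type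
  contains a copy of every set of size at most \<open>omega1\<close>, so order and dense sets are
  carried along an injection \<open>h\<close>, and the filter is pulled back.\<close>

lemma MA_omega1_transfer:
  fixes P :: "'q set"
  assumes "uncountable (UNIV :: 'p set)" "MA_omega1 TYPE('p)"
    and P: "|P| \<le>o omega1" "P \<noteq> {}" "partial_order_on P r" "ccc P r"
    and D: "|\<D>| \<le>o omega1" "\<And>D. D \<in> \<D> \<Longrightarrow> dense_in_poset P r D"
  obtains G where "filter_in_poset P r G" "\<forall>D\<in>\<D>. G \<inter> D \<noteq> {}"
proof -
  have "|P| \<le>o |UNIV :: 'p set|"
    using assms(1) P(1) uncountable_ordLeq_omega1 ordLeq_transitive by blast
  then obtain h :: "'q \<Rightarrow> 'p" where h: "inj_on h P" by (metis card_of_ordLeq)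
  let ?s = "map_prod h h ` r"
  have rP: "r \<subseteq> P \<times> P" using P(3) unfolding partial_order_on_def preorder_on_def by blast
  have s_iff: "(h p, h q) \<in> ?s \<longleftrightarrow> (p, q) \<in> r" if "p \<in> P" "q \<in> P" for p q
  proof
    assume "(h p, h q) \<in> ?s"
    then obtain a b where "(a, b) \<in> r" "h p = h a" "h q = h b" by auto
    then show "(p, q) \<in> r" using that rP inj_onD[OF h] by (metis SigmaD1 SigmaD2 subsetD)
  qed (auto intro: map_prod_imageI)
  have po: "partial_order_on (h ` P) ?s"
  proof -
    have tr: "trans r" and an: "antisym r" and re: "refl_on P r"
      using P(3) unfolding partial_order_on_def preorder_on_def by auto
    have "trans ?s"
    proof (rule transI)
      fix x y z assume "(x, y) \<in> ?s" "(y, z) \<in> ?s"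
      then obtain a b b' c where "(a,b) \<in> r" "(b',c) \<in> r" "x = h a" "y = h b" "y = h b'" "z = h c"
        by auto
      moreover then have "b = b'" using h rP by (metis SigmaD1 SigmaD2 inj_onD subsetD)
      ultimately show "(x, z) \<in> ?s" using transD[OF tr] by (metis map_prod_imageI)
    qed
    moreover have "antisym ?s"
    proof (rule antisymI)
      fix x y assume "(x, y) \<in> ?s" "(y, x) \<in> ?s"
      then obtain a b b' a' where "(a,b) \<in> r" "(b',a') \<in> r" "x = h a" "y = h b" "y = h b'" "x = h a'"
        by auto
      moreover then have "b = b'" "a = a'" using h rP by (metis SigmaD1 SigmaD2 inj_onD subsetD)+
      ultimately show "x = y" using antisymD[OF an] by metis
    qed
    moreover have "refl_on (h ` P) ?s"
      using re by (auto simp: refl_on_def)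
    moreover have "?s \<subseteq> h ` P \<times> h ` P" using rP by auto
    ultimately show ?thesis unfolding partial_order_on_def preorder_on_def by blast
  qed
  have cc: "ccc (h ` P) ?s"
    unfolding ccc_def
  proof (intro allI impI)
    fix A assume "A \<subseteq> h ` P" and A: "pairwise (\<lambda>p q. \<not> compatible_in (h ` P) ?s p q) A"
    then obtain A' where A': "A' \<subseteq> P" "A = h ` A'" by (meson subset_imageE)
    have "pairwise (\<lambda>p q. \<not> compatible_in P r p q) A'"
    proof (rule pairwiseI)
      fix p q assume pq: "p \<in> A'" "q \<in> A'" "p \<noteq> q"
      then have "h p \<noteq> h q" using h A'(1) by (meson inj_onD subsetD)
      then have "\<not> compatible_in (h ` P) ?s (h p) (h q)"
        using A pq A'(2) by (auto simp: pairwise_def)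
      then show "\<not> compatible_in P r p q"
        unfolding compatible_in_def by (metis image_eqI map_prod_imageI)
    qed
    then have "countable A'" using P(4) A'(1) unfolding ccc_def by blast
    then show "countable A" using A'(2) by simp
  qed
  have MA: "\<exists>G. filter_in_poset (h ` P) ?s G \<and> (\<forall>D\<in>\<E>. G \<inter> D \<noteq> {})"
    if "|\<E>| \<le>o omega1" "\<forall>D\<in>\<E>. dense_in_poset (h ` P) ?s D" for \<E>
    using assms(2) po cc P(2) that unfolding MA_omega1_def by simp
  have "|(`) h ` \<D>| \<le>o omega1" using D(1) card_of_image ordLeq_transitive by blast
  moreover have "dense_in_poset (h ` P) ?s D" if "D \<in> (`) h ` \<D>" for D
  proof -
    from that obtain D' where D': "D' \<in> \<D>" "D = h ` D'" by blast
    have "\<exists>q\<in>D. (q, p) \<in> ?s" if "p \<in> h ` P" for p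
      using D(2)[OF D'(1)] D'(2) that unfolding dense_in_poset_def
      by (metis (no_types, lifting) image_iff map_prod_imageI)
    moreover have "D \<subseteq> h ` P" using D(2)[OF D'(1)] D'(2) unfolding dense_in_poset_def by blast
    ultimately show ?thesis unfolding dense_in_poset_def by blast
  qed
  ultimately obtain G where G: "filter_in_poset (h ` P) ?s G"
    and GD: "\<forall>D \<in> (`) h ` \<D>. G \<inter> D \<noteq> {}"
    using MA by (meson image_is_empty)
  \<comment> \<open>The preimage of \<open>G\<close> is the required filter, because
    \<open>s_iff\<close> translates the order in both directions.\<close>
  let ?H = "{p \<in> P. h p \<in> G}"
  have GP: "G \<subseteq> h ` P" "G \<noteq> {}"
    and up: "\<forall>p\<in>G. \<forall>q\<in>h ` P. (p, q) \<in> ?s \<longrightarrow> q \<in> G"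
    and dir: "\<forall>p\<in>G. \<forall>q\<in>G. \<exists>s\<in>G. (s, p) \<in> ?s \<and> (s, q) \<in> ?s"
    using G unfolding filter_in_poset_def by - (elim conjE, assumption)+
  show thesis
  proof
    have "\<exists>s\<in>?H. (s, p) \<in> r \<and> (s, q) \<in> r" if pq: "p \<in> ?H" "q \<in> ?H" for p q
    proof -
      have "h p \<in> G" "h q \<in> G" using pq by auto
      then obtain s where "s \<in> G" "(s, h p) \<in> ?s" "(s, h q) \<in> ?s" using dir by metis
      moreover from this(1) obtain s' where "s' \<in> P" "s = h s'" using GP(1) by (metis imageE subsetD)
      ultimately have "s' \<in> ?H" "(s', p) \<in> r" "(s', q) \<in> r"
        using s_iff[of s' p] s_iff[of s' q] pq by simp_all
      then show ?thesis by (intro bexI conjI)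
    qed
    moreover have "q \<in> ?H" if "p \<in> ?H" "q \<in> P" "(p, q) \<in> r" for p q
      using that bspec[OF bspec[OF up, of "h p"], of "h q"] s_iff[of p q] by simp
    ultimately show "filter_in_poset P r ?H"
      unfolding filter_in_poset_def using GP by blast
    show "\<forall>D\<in>\<D>. ?H \<inter> D \<noteq> {}"
    proof
      fix D assume that: "D \<in> \<D>"
      have "D \<subseteq> P" using D(2)[OF that] unfolding dense_in_poset_def by blast
      moreover have "G \<inter> h ` D \<noteq> {}" using GD that by blast
      ultimately show "?H \<inter> D \<noteq> {}" by blast
    qed
  qed
qed

section \<open>Saturating sets\<close>

lemma saturating_subset: "saturating K Z d D \<Longrightarrow> D \<subseteq> Z"
  unfolding saturating_def by (elim conjE)

lemma saturatingD:
  assumes "saturating K Z d D" "finite E" "E \<subseteq> Z" "f \<notin> E" "Metric_space (insert f E) d'"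
    "distances_in K (insert f E) d'" "\<forall>x\<in>E. \<forall>y\<in>E. d' x y = d x y"
  obtains \<delta> where "\<delta> \<in> D" "isometry_onto (insert f E) d' (insert \<delta> E) d (id(f := \<delta>))"
proof -
  have "\<forall>E f d'. finite E \<and> E \<subseteq> Z \<and> f \<notin> E \<and>
      Metric_space (insert f E) d' \<and> distances_in K (insert f E) d' \<and>
      (\<forall>x\<in>E. \<forall>y\<in>E. d' x y = d x y) \<longrightarrow>
      (\<exists>\<delta>\<in>D. isometry_onto (insert f E) d' (insert \<delta> E) d (id(f := \<delta>)))"
    using assms(1) unfolding saturating_def by (elim conjE)
  then have "\<exists>\<delta>\<in>D. isometry_onto (insert f E) d' (insert \<delta> E) d (id(f := \<delta>))"
    using assms(2-) by simp
  then show thesis using that by (elim bexE)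
qed

lemma saturating_mono:
  assumes "saturating K Z d D" "D \<subseteq> D'" "D' \<subseteq> Z"
  shows "saturating K Z d D'"
  unfolding saturating_def
proof (intro conjI allI impI)
  fix E f d'
  assume "finite E \<and> E \<subseteq> Z \<and> f \<notin> E \<and> Metric_space (insert f E) d' \<and>
    distances_in K (insert f E) d' \<and> (\<forall>x\<in>E. \<forall>y\<in>E. d' x y = d x y)"
  then have "\<exists>\<delta>\<in>D. isometry_onto (insert f E) d' (insert \<delta> E) d (id(f := \<delta>))"
    using assms(1) unfolding saturating_def by simp
  then show "\<exists>\<delta>\<in>D'. isometry_onto (insert f E) d' (insert \<delta> E) d (id(f := \<delta>))"
    using assms(2) by (meson subsetD)
qed (rule assms(3))

text \<open>Hereditary separable saturation only speaks about subsets of \<open>Z - A\<close>; finite sets \<open>E\<close>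
  meeting \<open>A\<close> are handled by returning \<open>E \<inter> A\<close> to the space, and a realization
  over \<open>E\<close> never lies in \<open>E\<close>.\<close>

lemma countable_saturating_avoiding:
  assumes hss: "hereditarily_separably_saturated K Z d" and A: "countable A" "A \<subseteq> Z"
  obtains D where "countable D" "D \<subseteq> Z - A" "saturating K Z d D"
proof -
  have "\<exists>D. countable D \<and> saturating K (Z - (A - F)) d D" for F
  proof -
    have "countable (A - F)" "A - F \<subseteq> Z" using A by auto
    then show ?thesis
      using hss unfolding hereditarily_separably_saturated_def separably_saturated_def by blast
  qed
  then obtain D where D: "\<And>F. countable (D F)" "\<And>F. saturating K (Z - (A - F)) d (D F)"
    by metis
  \<comment> \<open>A countable set \<open>A\<close> has only countably many finite subsets
    \<open>F\<close>, so the union of one saturating set for each of them remains countable.\<close>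
  let ?D = "(\<Union>F\<in>Fpow A. D F) - A"
  have "countable ?D" using D(1) A(1) countable_Fpow by (metis countable_Diff countable_UN)
  moreover have sub: "?D \<subseteq> Z - A" using saturating_subset[OF D(2)] by blast
  moreover have "saturating K Z d ?D"
    unfolding saturating_def
  proof (intro conjI allI impI)
    show "?D \<subseteq> Z" using sub by blast
    fix E f d'
    assume "finite E \<and> E \<subseteq> Z \<and> f \<notin> E \<and> Metric_space (insert f E) d' \<and>
      distances_in K (insert f E) d' \<and> (\<forall>x\<in>E. \<forall>y\<in>E. d' x y = d x y)"
    then have E: "finite E" "E \<subseteq> Z" "f \<notin> E" and d': "Metric_space (insert f E) d'"
      "distances_in K (insert f E) d'" "\<forall>x\<in>E. \<forall>y\<in>E. d' x y = d x y" by simp_all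
    let ?F = "E \<inter> A"
    have "E \<subseteq> Z - (A - ?F)" using E(2) by blast
    then obtain \<delta> where \<delta>: "\<delta> \<in> D ?F"
      "isometry_onto (insert f E) d' (insert \<delta> E) d (id(f := \<delta>))"
      using saturatingD[OF D(2) E(1) _ E(3) d'] by metis
    \<comment> \<open>The map \<open>id(f := \<delta>)\<close> is injective and fixes
      \<open>E\<close>. Since \<delta> avoids \<open>E\<close>, it avoids the points of
      \<open>A\<close> that were returned to the space, and so all of \<open>A\<close>.\<close>
    have "\<delta> \<notin> E"
    proof
      assume "\<delta> \<in> E"
      moreover have "inj_on (id(f := \<delta>)) (insert f E)"
        using \<delta>(2) unfolding isometry_onto_def bij_betw_def by blast
      ultimately have "\<delta> = f" using inj_onD[of "id(f := \<delta>)" "insert f E" f \<delta>] by auto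
      then show False using E(3) \<open>\<delta> \<in> E\<close> by blast
    qed
    moreover have "\<delta> \<in> Z - (A - ?F)" using \<delta>(1) saturating_subset[OF D(2)] by blast
    moreover have "?F \<in> Fpow A" using E(1) by (auto simp: Fpow_def)
    ultimately show "\<exists>\<delta>\<in>?D. isometry_onto (insert f E) d' (insert \<delta> E) d (id(f := \<delta>))"
      using \<delta> by blast
  qed
  ultimately show thesis using that by blast
qed

text \<open>Partial isometries are sets of pairs, so that converses and unions stay within the same
  notion; being the graph of an injective map follows from the metric axioms.\<close>

definition isometric_relation :: "('a \<Rightarrow> 'a \<Rightarrow> real) \<Rightarrow> ('a \<times> 'a) set \<Rightarrow> bool" where
  "isometric_relation d p \<longleftrightarrow> (\<forall>u\<in>p. \<forall>v\<in>p. d (fst u) (fst v) = d (snd u) (snd v))"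

lemma isometric_relation_converse:
  assumes "isometric_relation d p"
  shows "isometric_relation d (p\<inverse>)"
  unfolding isometric_relation_def
proof (intro ballI)
  fix u v assume "u \<in> p\<inverse>" "v \<in> p\<inverse>"
  then have "prod.swap u \<in> p" "prod.swap v \<in> p" by auto
  then show "d (fst u) (fst v) = d (snd u) (snd v)"
    using assms unfolding isometric_relation_def by (metis fst_swap snd_swap)
qed

text \<open>Equality of points means distance zero, which the relation preserves in both
  directions.\<close>

lemma isometric_relation_fst_eq_iff:
  assumes "Metric_space X d" "p \<subseteq> X \<times> X" "isometric_relation d p" "u \<in> p" "v \<in> p"
  shows "fst u = fst v \<longleftrightarrow> snd u = snd v"
proof -
  interpret Metric_space X d by fact
  have "fst u \<in> X" "snd u \<in> X" "fst v \<in> X" "snd v \<in> X" using assms(2,4,5) by auto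
  then show ?thesis using assms(3-5) zero unfolding isometric_relation_def by metis
qed

section \<open>One-point extension of finite partial isometries\<close>

text \<open>The distances from \<open>x\<close> to the domain of \<open>p\<close>, transported along
  \<open>p\<close>, describe a one-point extension of the range of \<open>p\<close>. A point of
  \<open>D\<close> realizing this extension is the required image of \<open>x\<close>.\<close>

lemma extend_isometric_relation:
  fixes d :: "'a \<Rightarrow> 'a \<Rightarrow> real"
  assumes X: "Metric_space X d" "distances_in K X d" "infinite X"
    and D: "saturating K Z d D" "Z \<subseteq> X"
    and p: "finite p" "p \<subseteq> X \<times> Z" "isometric_relation d p"
    and x: "x \<in> X" "x \<notin> fst ` p"
  obtains y where "y \<in> D" "isometric_relation d (insert (x, y) p)"
proof -
  interpret Metric_space X d by fact
  let ?E = "snd ` p"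
  obtain f where f: "f \<notin> ?E" using X(3) p(1) by (meson finite_imageI finite_subset subsetI)
  have pX: "p \<subseteq> X \<times> X" using p(2) D(2) by blast
  have eq_iff: "fst u = fst v \<longleftrightarrow> snd u = snd v" if "u \<in> p" "v \<in> p" for u v
    using isometric_relation_fst_eq_iff[OF X(1) pX p(3) that] .
  \<comment> \<open>\<open>h\<close> sends the fresh name \<open>f\<close> to \<open>x\<close> and
    inverts \<open>p\<close> on its range. The metric on the extension is the pullback of
    \<open>d\<close> along \<open>h\<close>.\<close>
  define h where "h = (\<lambda>e. if e = f then x else fst (inv_into p snd e))"
  have h_snd: "h (snd u) = fst u" if "u \<in> p" for u
  proof -
    have "snd (inv_into p snd (snd u)) = snd u" "inv_into p snd (snd u) \<in> p"
      using that by (simp_all add: f_inv_into_f inv_into_into)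
    then have "fst (inv_into p snd (snd u)) = fst u" using eq_iff that by metis
    moreover have "snd u \<noteq> f" using f that by blast
    ultimately show ?thesis unfolding h_def by simp
  qed
  have h_f: "h f = x" unfolding h_def by simp
  have hX: "h e \<in> X" if "e \<in> insert f ?E" for e
  proof (cases "e = f")
    case False
    with that obtain u where "u \<in> p" "e = snd u" by blast
    then show ?thesis using h_snd[of u] pX by auto
  qed (simp add: h_f x(1))
  \<comment> \<open>Injectivity makes the pullback a metric and not just a pseudometric; for the
    point \<open>f\<close> it rests on \<open>x\<close> lying outside the domain of
    \<open>p\<close>.\<close>
  have h_inj: "inj_on h (insert f ?E)"
  proof (rule inj_onI)
    fix a b assume ab: "a \<in> insert f ?E" "b \<in> insert f ?E" "h a = h b"
    show "a = b"
    proof (cases "a = f \<or> b = f")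
      case True
      have "h e \<noteq> x" if "e \<in> ?E" for e
      proof -
        from that obtain u where "u \<in> p" "e = snd u" by blast
        then show ?thesis using h_snd[of u] x(2) by (metis imageI)
      qed
      then show ?thesis using True ab h_f by (metis insertE)
    next
      case False
      then obtain u v where uv: "u \<in> p" "v \<in> p" "a = snd u" "b = snd v" using ab by blast
      then show ?thesis using h_snd[of u] h_snd[of v] eq_iff[of u v] ab(3) by simp
    qed
  qed
  let ?d = "\<lambda>a b. d (h a) (h b)"
  have m: "Metric_space (insert f ?E) ?d"
  proof
    show "?d a b = 0 \<longleftrightarrow> a = b" if "a \<in> insert f ?E" "b \<in> insert f ?E" for a b
      using hX[OF that(1)] hX[OF that(2)] h_inj that by (metis inj_onD zero)
    show "?d a c \<le> ?d a b + ?d b c"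
      if "a \<in> insert f ?E" "b \<in> insert f ?E" "c \<in> insert f ?E" for a b c
      using that by (intro triangle hX)
  qed (simp_all add: commute)
  have k: "distances_in K (insert f ?E) ?d"
    using X(2) hX unfolding distances_in_def by metis
  have e: "\<forall>a\<in>?E. \<forall>b\<in>?E. ?d a b = d a b"
    using p(3) unfolding isometric_relation_def by (simp add: h_snd)
  have "finite ?E" "?E \<subseteq> Z" using p(1,2) by auto
  then obtain y where y: "y \<in> D"
    "isometry_onto (insert f ?E) ?d (insert y ?E) d (id(f := y))"
    using saturatingD[OF D(1) _ _ f m k e] by metis
  have new: "d x (fst u) = d y (snd u)" if "u \<in> p" for u
  proof -
    have "d ((id(f := y)) f) ((id(f := y)) (snd u)) = ?d f (snd u)"
      using y(2) that unfolding isometry_onto_def by (meson imageI insertCI)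
    moreover have "snd u \<noteq> f" using f that by blast
    ultimately show ?thesis using h_f h_snd[OF that] by simp
  qed
  have "y \<in> X" using y(1) D(2) saturating_subset[OF D(1)] by blast
  then have "d x x = d y y" using x(1) by simp
  then have "isometric_relation d (insert (x, y) p)"
    using p(3) unfolding isometric_relation_def
    by (simp add: new) (metis commute new)
  then show thesis using that y(1) by blast
qed


section \<open>Partition into countable saturating levels\<close>

text \<open>A maximal disjoint family of countable blocks with the required saturation need not exhaust
  \<open>X\<close>, but it is uncountable, so that every block can absorb at most one of the remaining points.\<close>

lemma obtain_saturated_levels:
  fixes X Y :: "'a set"
  assumes card_X: "|X| =o omega1" and Y: "Y \<subseteq> X"
    and hss_X: "hereditarily_separably_saturated K X d"
    and hss_Y: "hereditarily_separably_saturated K Y d"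
  obtains lev :: "'a \<Rightarrow> 'a set" where "\<And>l. countable {z \<in> X. lev z = l}"
    "\<And>z. z \<in> X \<Longrightarrow> saturating K X d {w \<in> X. lev w = lev z}"
    "\<And>z. z \<in> X \<Longrightarrow> saturating K Y d {w \<in> Y. lev w = lev z}"
proof -
  let ?Bs = "{B. B \<subseteq> X \<and> countable B \<and> saturating K X d B \<and> saturating K Y d (B \<inter> Y)}"
  obtain \<B> where \<B>: "\<B> \<subseteq> ?Bs" "uncountable \<B>" "disjoint_family_on (\<lambda>B. B) \<B>"
  proof (rule uncountable_disjoint_subfamily)
    show "countable B" if "B \<in> ?Bs" for B using that by simp
    fix C :: "'a set" assume C: "countable C"
    obtain D1 where D1: "countable D1" "D1 \<subseteq> X - (C \<inter> X)" "saturating K X d D1"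
      by (rule countable_saturating_avoiding[OF hss_X, of "C \<inter> X"]) (use C in auto)
    obtain D2 where D2: "countable D2" "D2 \<subseteq> Y - (C \<inter> Y)" "saturating K Y d D2"
      by (rule countable_saturating_avoiding[OF hss_Y, of "C \<inter> Y"]) (use C in auto)
    obtain x where x: "x \<in> X" "x \<notin> C"
      using uncountable_omega1[OF card_X] C by (meson countable_subset subsetI)
    let ?B = "insert x (D1 \<union> D2)"
    have B: "?B \<subseteq> X" "?B \<inter> C = {}" using x D1(2) D2(2) Y by auto
    have "saturating K X d ?B" using saturating_mono[OF D1(3) _ B(1)] by blast
    moreover have "D2 \<subseteq> ?B \<inter> Y" using D2(2) by blast
    then have "saturating K Y d (?B \<inter> Y)" using saturating_mono[OF D2(3)] by blast
    ultimately have "?B \<in> ?Bs" using B(1) D1(1) D2(1) by simp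
    then show "\<exists>B\<in>?Bs. B \<noteq> {} \<and> B \<inter> C = {}" using B(2) by (intro bexI[of _ ?B]) auto
  qed
  \<comment> \<open>As |X| is \<open>omega1\<close> and the family of blocks is uncountable, the
    leftover points inject into the blocks.\<close>
  have "|X - \<Union>\<B>| \<le>o |X|" by (rule card_of_mono1) blast
  moreover have "|X| \<le>o |\<B>|"
    using card_X \<B>(2) uncountable_ordLeq_omega1 ordIso_ordLeq_trans by metis
  ultimately have "|X - \<Union>\<B>| \<le>o |\<B>|" by (rule ordLeq_transitive)
  then obtain j where j: "inj_on j (X - \<Union>\<B>)" "j ` (X - \<Union>\<B>) \<subseteq> \<B>" by (metis card_of_ordLeq)
  \<comment> \<open>The blocks themselves serve as labels: a covered point is labelled by its own
    block, a leftover point by the block that \<open>j\<close> assigns to it.\<close>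
  define lev where "lev z = (if z \<in> \<Union>\<B> then SOME B. B \<in> \<B> \<and> z \<in> B else j z)" for z
  have lev_block: "lev z = B" if "z \<in> B" "B \<in> \<B>" for z B
  proof -
    have "lev z \<in> \<B> \<and> z \<in> lev z"
      using that someI[of "\<lambda>B. B \<in> \<B> \<and> z \<in> B" B] unfolding lev_def by auto
    then show ?thesis using that \<B>(3) unfolding disjoint_family_on_def by blast
  qed
  have lev_rest: "lev z = j z" if "z \<notin> \<Union>\<B>" for z using that unfolding lev_def by simp
  have lev_in: "lev z \<in> \<B>" if "z \<in> X" for z
  proof (cases "z \<in> \<Union>\<B>")
    case True
    then show ?thesis using lev_block by auto
  next
    case False
    with that show ?thesis using j(2) lev_rest[OF False] by blast
  qed
  \<comment> \<open>Each level contains the block that labels it, so it inherits saturation by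
    monotonicity.\<close>
  have sub: "lev z \<subseteq> {w \<in> X. lev w = lev z}" if "z \<in> X" for z
    using lev_block[OF _ lev_in[OF that]] lev_in[OF that] \<B>(1) by auto
  show thesis
  proof
    fix l
    show "countable {z \<in> X. lev z = l}"
    proof (cases "l \<in> \<B>")
      case True
      let ?R = "{z \<in> X - \<Union>\<B>. j z = l}"
      have "countable ?R"
      proof (rule countable_image_inj_on)
        have "j ` ?R \<subseteq> {l}" by blast
        then show "countable (j ` ?R)" by (rule countable_subset) simp
        show "inj_on j ?R" using j(1) by (rule inj_on_subset) blast
      qed
      moreover have "countable l" using True \<B>(1) by blast
      moreover have "{z \<in> X. lev z = l} \<subseteq> l \<union> ?R"
      proof
        fix z assume z: "z \<in> {z \<in> X. lev z = l}"
        show "z \<in> l \<union> ?R"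
        proof (cases "z \<in> \<Union>\<B>")
          case True
          then obtain B where "B \<in> \<B>" "z \<in> B" by blast
          then show ?thesis using lev_block[of z B] z by simp
        qed (use z lev_rest[of z] in simp)
      qed
      ultimately show ?thesis by (metis countable_Un countable_subset)
    next
      case False
      then have empty: "{z \<in> X. lev z = l} = {}" using lev_in by blast
      show ?thesis unfolding empty by (rule countable_empty)
    qed
  next
    fix z assume z: "z \<in> X"
    then have "saturating K X d (lev z)" "saturating K Y d (lev z \<inter> Y)" using lev_in \<B>(1) by blast+
    moreover have "lev z \<inter> Y \<subseteq> {w \<in> Y. lev w = lev z}" using sub[OF z] by blast
    ultimately show "saturating K X d {w \<in> X. lev w = lev z}"
      "saturating K Y d {w \<in> Y. lev w = lev z}"
      using sub[OF z] by (auto intro: saturating_mono)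
  qed
qed

section \<open>Finite level-preserving partial isometries\<close>

locale levelled_subspace =
  fixes K :: "real set" and X Y :: "'a set" and d :: "'a \<Rightarrow> 'a \<Rightarrow> real" and lev :: "'a \<Rightarrow> 'b"
  assumes metric: "Metric_space X d" and distances: "distances_in K X d"
    and card_X: "|X| =o omega1" and rect: "rectangular X d" and Y: "Y \<subseteq> X"
    and countable_level: "\<And>l. countable {z \<in> X. lev z = l}"
    and saturating_X: "\<And>z. z \<in> X \<Longrightarrow> saturating K X d {w \<in> X. lev w = lev z}"
    and saturating_Y: "\<And>z. z \<in> X \<Longrightarrow> saturating K Y d {w \<in> Y. lev w = lev z}"
begin

text \<open>Preserving levels leaves only countably many possible images for a given point; the
  counting in the chain condition relies on this.\<close>

definition conditions :: "('a \<times> 'a) set set" where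
  "conditions = {p. finite p \<and> p \<subseteq> X \<times> Y \<and> isometric_relation d p \<and>
     (\<forall>u\<in>p. lev (fst u) = lev (snd u))}"

definition extends :: "('a \<times> 'a) set rel" where
  "extends = {(p, q). p \<in> conditions \<and> q \<in> conditions \<and> q \<subseteq> p}"

lemma infinite_X: "infinite X"
  using uncountable_infinite[OF uncountable_omega1[OF card_X]] .

lemma partial_order_extends: "partial_order_on conditions extends"
  unfolding partial_order_on_def preorder_on_def refl_on_def trans_def antisym_def extends_def
  by auto

text \<open>Conditions are finite subsets of a set of size \<open>omega1\<close>. This bound allows
  the poset to be copied into the type for which the axiom is assumed.\<close>

lemma card_conditions: "|conditions| \<le>o omega1"
proof -
  have inf: "infinite (X \<times> X)" using infinite_X by (auto simp: finite_cartesian_product_iff)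
  have "conditions \<subseteq> Fpow (X \<times> X)" using Y unfolding conditions_def Fpow_def by auto
  then have "|conditions| \<le>o |Fpow (X \<times> X)|" by (rule card_of_mono1)
  moreover have "|Fpow (X \<times> X)| \<le>o |X \<times> X|" by (rule card_of_Fpow_ordLeq_infinite[OF inf])
  moreover have "|X \<times> X| =o |X|" by (rule card_of_Times_same_infinite[OF infinite_X])
  ultimately show ?thesis using card_X by (meson ordLeq_ordIso_trans ordLeq_transitive)
qed

section \<open>The countable chain condition\<close>

text \<open>Write \<open>us\<close> as pairs (a_i, b_i) and \<open>vs\<close> as pairs (a'_i, b'_i).
  At equal indices, the first clause of \<open>alike\<close> at positions i and n + i gives d(a_i,
  a'_i) = d(b_i, b'_i). For i \<noteq> j the third clause gives d(a_i, a'_j) = d(a_i, a_j) = d(b_i,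
  b_j) = d(b_i, b'_j); it applies because distinct pairs of an isometric relation differ in both
  coordinates.\<close>

lemma alike_imp_isometric:
  assumes ls: "length us = n" "length vs = n" "distinct us"
    and us: "set us \<subseteq> X \<times> X" "isometric_relation d (set us)"
    and alike: "alike d (map fst us @ map snd us) (map fst vs @ map snd vs)"
    and uv: "u \<in> set us" "v \<in> set vs"
  shows "d (fst u) (fst v) = d (snd u) (snd v)"
proof -
  let ?xs = "map fst us @ map snd us" and ?ys = "map fst vs @ map snd vs"
  obtain i j where ij: "i < n" "j < n" "u = us ! i" "v = vs ! j"
    using uv ls by (metis in_set_conv_nth)
  have nth: "?xs ! k = fst (us ! k)" "?ys ! k = fst (vs ! k)"
    "?xs ! (n + k) = snd (us ! k)" "?ys ! (n + k) = snd (vs ! k)" if "k < n" for k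
    using that ls by (simp_all add: nth_append)
  have al: "d (?xs ! a) (?ys ! a) = d (?xs ! b) (?ys ! b)"
    "?xs ! a \<noteq> ?xs ! b \<Longrightarrow> d (?xs ! a) (?xs ! b) = d (?xs ! a) (?ys ! b)"
    if "a < 2 * n" "b < 2 * n" for a b
  proof -
    have "a < length ?xs" "b < length ?xs" using that ls by simp_all
    then show "d (?xs ! a) (?ys ! a) = d (?xs ! b) (?ys ! b)"
      "?xs ! a \<noteq> ?xs ! b \<Longrightarrow> d (?xs ! a) (?xs ! b) = d (?xs ! a) (?ys ! b)"
      using alike unfolding alike_def by blast+
  qed
  show ?thesis
  proof (cases "i = j")
    case True
    then show ?thesis using al(1)[of i "n + i"] ij nth by simp
  next
    case False
    have mem: "us ! i \<in> set us" "us ! j \<in> set us" using ij ls by auto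
    have "us ! i \<noteq> us ! j" using False ls ij by (simp add: nth_eq_iff_index_eq)
    then have ne: "fst (us ! i) \<noteq> fst (us ! j)" "snd (us ! i) \<noteq> snd (us ! j)"
      using isometric_relation_fst_eq_iff[OF metric us mem] by (auto simp: prod_eq_iff)
    have "d (fst (us ! i)) (fst (vs ! j)) = d (fst (us ! i)) (fst (us ! j))"
      using al(2)[of i j] ij nth ne by simp
    also have "\<dots> = d (snd (us ! i)) (snd (us ! j))"
      using us(2) mem unfolding isometric_relation_def by blast
    also have "\<dots> = d (snd (us ! i)) (snd (vs ! j))"
      using al(2)[of "n + i" "n + j"] ij nth ne by simp
    finally show ?thesis using ij by simp
  qed
qed

lemma ccc_conditions: "ccc conditions extends"
  unfolding ccc_def
proof (intro allI impI)
  fix A assume A: "A \<subseteq> conditions"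
    and incomp: "pairwise (\<lambda>p q. \<not> compatible_in conditions extends p q) A"
  have cond: "finite p" "p \<subseteq> X \<times> X" "isometric_relation d p"
    "\<And>u. u \<in> p \<Longrightarrow> lev (fst u) = lev (snd u)" if "p \<in> A" for p
    using that A Y unfolding conditions_def by auto
  show "countable A"
  proof (rule ccontr)
    assume "uncountable A"
    \<comment> \<open>The Delta-system consists of sets of levels, not of points, so that outside
      the root two conditions share no level at all. By level preservation the first coordinates
      alone determine these levels.\<close>
    then obtain B R where B: "B \<subseteq> A" "uncountable B" and R: "finite R"
      and delta: "\<And>p q. p \<in> B \<Longrightarrow> q \<in> B \<Longrightarrow> p \<noteq> q \<Longrightarrow> lev ` fst ` p \<inter> lev ` fst ` q = R"
      using delta_system[of A "\<lambda>p. lev ` fst ` p"] cond(1) by (metis finite_imageI)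
    define core :: "('a \<times> 'a) set \<Rightarrow> _" where "core p = {u \<in> p. lev (fst u) \<in> R}" for p
    let ?S = "\<Union>l\<in>R. {z \<in> X. lev z = l}"
    have "countable ?S" using R countable_level by (simp add: countable_finite)
    then have Fpow: "countable (Fpow (?S \<times> ?S))" by (intro countable_Fpow countable_SIGMA)
    have "core ` B \<subseteq> Fpow (?S \<times> ?S)"
    proof
      fix c assume "c \<in> core ` B"
      then obtain p where p: "p \<in> A" "c = core p" using B(1) by blast
      have "u \<in> ?S \<times> ?S" if "u \<in> core p" for u
        using that cond(2)[OF p(1)] cond(4)[OF p(1), of u] unfolding core_def by auto
      moreover have "finite (core p)" using cond(1)[OF p(1)] unfolding core_def by simp
      ultimately show "c \<in> Fpow (?S \<times> ?S)" using p(2) unfolding Fpow_def by blast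
    qed
    then have "countable (core ` B)" using Fpow by (rule countable_subset)
    then obtain c where "uncountable {p \<in> B. core p = c}"
      by (rule uncountable_constant_fibre[OF B(2)])
    \<comment> \<open>Fixing the size of the remainder gives all tuples the same length.\<close>
    then obtain n where unc: "uncountable {p \<in> {p \<in> B. core p = c}. card (p - c) = n}"
      by (rule uncountable_constant_fibre[where g = "\<lambda>p. card (p - c)"]) auto
    define C where "C = {p \<in> {p \<in> B. core p = c}. card (p - c) = n}"
    have C: "p \<in> B" "p \<in> A" "core p = c" "c \<subseteq> p" "card (p - c) = n" if "p \<in> C" for p
      using that B(1) unfolding C_def core_def by auto
    have "\<exists>us. set us = p - c \<and> distinct us" if "p \<in> C" for p
      using finite_distinct_list[of "p - c"] cond(1)[OF C(2)[OF that]] by blast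
    then obtain ls where ls: "\<And>p. p \<in> C \<Longrightarrow> set (ls p) = p - c" "\<And>p. p \<in> C \<Longrightarrow> distinct (ls p)"
      by metis
    have len: "length (ls p) = n" if "p \<in> C" for p
      using ls[OF that] C(5)[OF that] by (metis distinct_card)
    define t where "t p = map fst (ls p) @ map snd (ls p)" for p
    \<comment> \<open>The tuple recovers the list of pairs, hence the remainder, and with the common
      part \<open>c\<close> the whole condition. So there are uncountably many tuples.\<close>
    have "inj_on t C"
    proof (rule inj_onI)
      fix p q assume pq: "p \<in> C" "q \<in> C" "t p = t q"
      then have "map fst (ls p) = map fst (ls q)" "map snd (ls p) = map snd (ls q)"
        using len unfolding t_def by auto
      then have "ls p = ls q" by (metis zip_map_fst_snd)
      then have "p - c = q - c" using ls(1) pq by metis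
      then show "p = q" using C(4) pq by blast
    qed
    then have "uncountable (t ` C)"
      using unc countable_image_inj_on unfolding C_def by blast
    then obtain F where F: "F \<subseteq> t ` C" "|F| =o omega1" by (rule obtain_subset_omega1)
    have "t p \<in> {xs. length xs = 2 * n \<and> set xs \<subseteq> X}" if "p \<in> C" for p
      using ls(1)[OF that] cond(2)[OF C(2)[OF that]] len[OF that] unfolding t_def by auto
    then have F_tuples: "F \<subseteq> {xs. length xs = 2 * n \<and> set xs \<subseteq> X}"
      using F(1) by blast
    have obtain_C: thesis
      if "xs \<in> F" "ys \<in> F" "xs \<noteq> ys"
        "\<And>p q. p \<in> C \<Longrightarrow> q \<in> C \<Longrightarrow> p \<noteq> q \<Longrightarrow> xs = t p \<Longrightarrow> ys = t q \<Longrightarrow> thesis" for xs ys thesis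
    proof -
      have "xs \<in> t ` C" "ys \<in> t ` C" using F(1) that(1,2) by auto
      then show thesis using that(3,4) by (elim imageE) metis
    qed
    \<comment> \<open>A common entry would, as a first or second coordinate, come from remainder
      pairs of both conditions on one level. That level lies in the root, which puts the pairs into
      the core \<open>c\<close>.\<close>
    have "disjoint_family_on set F"
      unfolding disjoint_family_on_def
    proof (intro ballI impI equals0I)
      fix xs ys z assume xy: "xs \<in> F" "ys \<in> F" "xs \<noteq> ys" and z: "z \<in> set xs \<inter> set ys"
      obtain p q where pq: "p \<in> C" "q \<in> C" "p \<noteq> q" "xs = t p" "ys = t q"
        by (rule obtain_C[OF xy])
      have lev_z: "\<exists>u\<in>p - c. lev z = lev (fst u)" if "p \<in> C" "z \<in> set (t p)" for p
        using that ls(1)[OF that(1)] cond(4)[OF C(2)[OF that(1)]] unfolding t_def by auto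
      obtain u v where uv: "u \<in> p - c" "lev z = lev (fst u)" "v \<in> q - c" "lev z = lev (fst v)"
        using lev_z[of p] lev_z[of q] z pq by blast
      have "lev z \<in> R" using delta[of p q] C(1) pq(1-3) uv by blast
      then have "u \<in> core p" using uv unfolding core_def by simp
      then show False using C(3)[OF pq(1)] uv(1) by blast
    qed
    then have "\<exists>xs\<in>F. \<exists>ys\<in>F. xs \<noteq> ys \<and> alike d xs ys"
      using rect F(2) F_tuples unfolding rectangular_def by simp
    then obtain xs ys where xy: "xs \<in> F" "ys \<in> F" "xs \<noteq> ys" and al: "alike d xs ys"
      by (elim bexE conjE)
    obtain p q where pq: "p \<in> C" "q \<in> C" "p \<noteq> q" "xs = t p" "ys = t q"
      by (rule obtain_C[OF xy])
    \<comment> \<open>A pair of \<open>c\<close> belongs to both conditions, so only pairs from the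
      two remainders call for alikeness.\<close>
    have cross: "d (fst u) (fst v) = d (snd u) (snd v)" if uv: "u \<in> p" "v \<in> q" for u v
    proof (cases "u \<in> c \<or> v \<in> c")
      case True
      then have "u \<in> p \<and> v \<in> p \<or> u \<in> q \<and> v \<in> q" using uv C(4) pq by blast
      then show ?thesis
        using cond(3)[OF C(2)[OF pq(1)]] cond(3)[OF C(2)[OF pq(2)]]
        unfolding isometric_relation_def by blast
    next
      case False
      have "set (ls p) \<subseteq> X \<times> X" "isometric_relation d (set (ls p))"
        using ls(1)[OF pq(1)] cond(2,3)[OF C(2)[OF pq(1)]] unfolding isometric_relation_def by auto
      then show ?thesis
        using alike_imp_isometric[OF len[OF pq(1)] len[OF pq(2)] ls(2)[OF pq(1)], of u v]
          al pq uv False ls(1) unfolding t_def by auto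
    qed
    interpret Metric_space X d by (rule metric)
    have "isometric_relation d (p \<union> q)"
      unfolding isometric_relation_def
    proof (intro ballI)
      fix u v assume "u \<in> p \<union> q" "v \<in> p \<union> q"
      then consider "u \<in> p" "v \<in> p" | "u \<in> q" "v \<in> q" | "u \<in> p" "v \<in> q" | "v \<in> p" "u \<in> q"
        by blast
      then show "d (fst u) (fst v) = d (snd u) (snd v)"
      proof cases
        case 1
        then show ?thesis using cond(3)[OF C(2)[OF pq(1)]] unfolding isometric_relation_def by blast
      next
        case 2
        then show ?thesis using cond(3)[OF C(2)[OF pq(2)]] unfolding isometric_relation_def by blast
      next
        case 3
        then show ?thesis by (rule cross)
      next
        case 4
        then show ?thesis using cross[of v u] by (metis commute)
      qed
    qed
    moreover have "p \<in> conditions" "q \<in> conditions" using A C(2) pq(1,2) by auto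
    ultimately have "p \<union> q \<in> conditions" unfolding conditions_def by auto
    then have "compatible_in conditions extends p q"
      using \<open>p \<in> conditions\<close> \<open>q \<in> conditions\<close> unfolding compatible_in_def extends_def by blast
    then show False using incomp C(2) pq(1-3) unfolding pairwise_def by blast
  qed
qed

section \<open>Density of domain and range requirements\<close>

text \<open>The trace on \<open>Y\<close> of the level of \<open>x\<close> saturates
  \<open>Y\<close>, so a suitable image of \<open>x\<close> exists on its own level.\<close>

lemma dense_domain:
  assumes x: "x \<in> X"
  shows "dense_in_poset conditions extends {p \<in> conditions. x \<in> fst ` p}"
  unfolding dense_in_poset_def
proof (intro conjI ballI)
  fix p assume p: "p \<in> conditions"
  show "\<exists>q\<in>{p \<in> conditions. x \<in> fst ` p}. (q, p) \<in> extends"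
  proof (cases "x \<in> fst ` p")
    case True
    then show ?thesis using p unfolding extends_def by blast
  next
    case False
    have "finite p" "p \<subseteq> X \<times> Y" "isometric_relation d p" using p unfolding conditions_def by auto
    then obtain y where y: "y \<in> {w \<in> Y. lev w = lev x}" "isometric_relation d (insert (x, y) p)"
      using extend_isometric_relation[OF metric distances infinite_X saturating_Y[OF x] Y _ _ _ x False]
      by metis
    then have "insert (x, y) p \<in> conditions" using p x unfolding conditions_def by auto
    then show ?thesis using p unfolding extends_def by (intro bexI[of _ "insert (x, y) p"]) auto
  qed
qed blast

text \<open>The extension lemma is applied to the converse of the condition, with the level of
  \<open>y\<close> in \<open>X\<close> as the saturating set.\<close>

lemma dense_range:
  assumes y: "y \<in> Y"
  shows "dense_in_poset conditions extends {p \<in> conditions. y \<in> snd ` p}"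
  unfolding dense_in_poset_def
proof (intro conjI ballI)
  fix p assume p: "p \<in> conditions"
  show "\<exists>q\<in>{p \<in> conditions. y \<in> snd ` p}. (q, p) \<in> extends"
  proof (cases "y \<in> snd ` p")
    case True
    then show ?thesis using p unfolding extends_def by blast
  next
    case False
    have yX: "y \<in> X" using y Y by blast
    have "y \<notin> fst ` (p\<inverse>)" using False by force
    moreover have "finite (p\<inverse>)" "p\<inverse> \<subseteq> X \<times> X" "isometric_relation d (p\<inverse>)"
      using p Y unfolding conditions_def by (auto intro: isometric_relation_converse)
    ultimately obtain x where x: "x \<in> {w \<in> X. lev w = lev y}"
      "isometric_relation d (insert (y, x) (p\<inverse>))"
      using extend_isometric_relation[OF metric distances infinite_X saturating_X[OF yX]
          subset_refl _ _ _ yX]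
      by metis
    have "(insert (y, x) (p\<inverse>))\<inverse> = insert (x, y) p" by auto
    then have "isometric_relation d (insert (x, y) p)"
      using isometric_relation_converse[OF x(2)] by simp
    then have "insert (x, y) p \<in> conditions" using p x y unfolding conditions_def by auto
    then show ?thesis using p unfolding extends_def by (intro bexI[of _ "insert (x, y) p"]) auto
  qed
qed blast

section \<open>The isometry read off from the filter\<close>

lemma isometric_if_MA:
  assumes "uncountable (UNIV :: 'p set)" "MA_omega1 TYPE('p)"
  shows "isometric X d Y d"
proof -
  interpret Metric_space X d by (rule metric)
  let ?D = "\<lambda>x. {p \<in> conditions. x \<in> fst ` p}" and ?E = "\<lambda>y. {p \<in> conditions. y \<in> snd ` p}"
  have card_image: "|f ` Z| \<le>o omega1" if "Z \<subseteq> X" for f :: "'a \<Rightarrow> ('a \<times> 'a) set set" and Z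
    using card_of_image[of f Z] card_of_mono1[OF that] card_X
    by (meson ordLeq_ordIso_trans ordLeq_transitive)
  \<comment> \<open>Infinity of \<open>omega1\<close> ensures that two families of at most
    \<open>omega1\<close> many dense sets have a union within the same bound.\<close>
  have "infinite (Field omega1)"
    using infinite_X card_X by (metis card_of_Field_ordIso card_of_ordIso_finite
        Card_order_omega1 ordIso_transitive ordIso_symmetric)
  then have card: "|?D ` X \<union> ?E ` Y| \<le>o omega1"
    by (intro card_of_Un_ordLeq_infinite_Field card_image Y subset_refl Card_order_omega1)
  have dense: "dense_in_poset conditions extends D" if "D \<in> ?D ` X \<union> ?E ` Y" for D
    using that dense_domain dense_range by blast
  have "{} \<in> conditions" unfolding conditions_def isometric_relation_def by simp
  then have "conditions \<noteq> {}" by blast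
  then obtain G where G: "filter_in_poset conditions extends G"
    and GD: "\<forall>D\<in>?D ` X \<union> ?E ` Y. G \<inter> D \<noteq> {}"
    by (rule MA_omega1_transfer[OF assms card_conditions _ partial_order_extends ccc_conditions
          card dense])
  \<comment> \<open>Any two pairs of the union lie in one common condition, because the filter is
    directed.\<close>
  have g_iso: "isometric_relation d (\<Union>G)"
    unfolding isometric_relation_def
  proof (intro ballI)
    fix u v assume "u \<in> \<Union>G" "v \<in> \<Union>G"
    then obtain p q where "p \<in> G" "q \<in> G" "u \<in> p" "v \<in> q" by blast
    moreover have "\<forall>p\<in>G. \<forall>q\<in>G. \<exists>s\<in>G. (s, p) \<in> extends \<and> (s, q) \<in> extends"
      using G unfolding filter_in_poset_def by (elim conjE)
    ultimately obtain s where "(s, p) \<in> extends" "(s, q) \<in> extends" by metis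
    then have "s \<in> conditions" "u \<in> s" "v \<in> s"
      using \<open>u \<in> p\<close> \<open>v \<in> q\<close> unfolding extends_def by auto
    then show "d (fst u) (fst v) = d (snd u) (snd v)"
      unfolding conditions_def isometric_relation_def by blast
  qed
  have g_sub: "\<Union>G \<subseteq> X \<times> Y"
    using G unfolding filter_in_poset_def conditions_def by blast
  then have g_eq: "fst u = fst v \<longleftrightarrow> snd u = snd v" if "u \<in> \<Union>G" "v \<in> \<Union>G" for u v
    using isometric_relation_fst_eq_iff[OF metric _ g_iso that] Y by blast
  have "\<exists>y. (x, y) \<in> \<Union>G" if "x \<in> X" for x
  proof -
    have "G \<inter> ?D x \<noteq> {}" using GD that by blast
    then show ?thesis by force
  qed
  then obtain g where g: "\<And>x. x \<in> X \<Longrightarrow> (x, g x) \<in> \<Union>G" by metis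
  have "isometry_onto X d Y d g"
    unfolding isometry_onto_def
  proof (intro conjI ballI)
    show "d (g x) (g y) = d x y" if "x \<in> X" "y \<in> X" for x y
      using g_iso g[OF that(1)] g[OF that(2)] unfolding isometric_relation_def
      by (metis fst_conv snd_conv)
    have "inj_on g X"
      using g_eq g by (metis fst_conv inj_onI snd_conv)
    moreover have "g ` X = Y"
    proof
      show "g ` X \<subseteq> Y" using g g_sub by blast
      show "Y \<subseteq> g ` X"
      proof
        fix y assume y: "y \<in> Y"
        then have "G \<inter> ?E y \<noteq> {}" using GD by blast
        then obtain x where x: "(x, y) \<in> \<Union>G" by force
        then have "x \<in> X" using g_sub by blast
        \<comment> \<open>The pairs \<open>(x, g x)\<close> and \<open>(x, y)\<close> both lie in
          the union, which is single-valued by \<open>g_eq\<close>.\<close>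
        then have "g x = y" using g_eq[OF g[OF \<open>x \<in> X\<close>] x] by simp
        then show "y \<in> g ` X" using \<open>x \<in> X\<close> by blast
      qed
    qed
    ultimately show "bij_betw g X Y" unfolding bij_betw_def by blast
  qed
  then show ?thesis unfolding isometric_def by blast
qed

end

theorem mainTheorem8:
  fixes K :: "real set" and X Y :: "'a set" and d :: "'a \<Rightarrow> 'a \<Rightarrow> real"
  assumes "uncountable (UNIV :: 'p set)" and "MA_omega1 TYPE('p)"
    and "K \<subseteq> {0..}" and "countable K"
    and "Metric_space X d" and "distances_in K X d" and "|X| =o omega1"
    and "rectangular X d" and "hereditarily_separably_saturated K X d"
    and "Y \<subseteq> X" and "uncountable Y" and "hereditarily_separably_saturated K Y d"
  shows "isometric X d Y d"
proof (rule obtain_saturated_levels[OF assms(7,10,9,12)])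
  fix lev :: "'a \<Rightarrow> 'a set"
  assume lev: "\<And>l. countable {z \<in> X. lev z = l}"
    "\<And>z. z \<in> X \<Longrightarrow> saturating K X d {w \<in> X. lev w = lev z}"
    "\<And>z. z \<in> X \<Longrightarrow> saturating K Y d {w \<in> Y. lev w = lev z}"
  interpret levelled_subspace K X Y d lev
    by (rule levelled_subspace.intro) (fact assms lev)+
  show "isometric X d Y d" by (rule isometric_if_MA[OF assms(1,2)])
qed

end
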